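(* The following two graphs are isomorphic under $\Phi_{n-1}$: (1) the graph whose vertices are the words for $\rho_{n-1}^n$ in $M_{n-1}$, with an edge between two words whenever they differ by the application of a single defining relation of $M_{n-1}$; (2) the graph whose vertices are the Schröder trees with $n$ leaves, with an edge between two trees whenever they differ by the application of a local move.
   Context: Monoid: for $m\ge 1$, $M_m$ is the monoid with presentation $\langle \rho_1,\dots,\rho_m \mid \rho_1\rho_m\rho_i=\rho_{i+1}\rho_m \text{ for all } 1\le i\le m-1\rangle$; $M_0$ is the trivial monoid. A word for $x\in M_m$ is a finite sequence of letters in $\{\rho_1,\dots,\rho_m\}$ whose product in $M_m$ is $x$. Convention: $\rho_0=e$ (identity; as a letter it is deleted). Trees: a rooted plane tree is either the empty tree (a single leaf, no inner vertex) or a tuple $(r,(T_1,\dots,T_k))$ with $r$ the root and $T_1,\dots,T_k$ an ordered (left to right) list of rooted plane trees, whose roots are the children of $r$. A Schröder tree is a rooted plane tree in which every inner vertex has at least two children. In what follows, leaves count as vertices. Post-order traversal: visit recursively $T_1$, then $T_2$, ..., then $T_k$, and finally the root $r$; the empty tree is visited by visiting its leaf. Labelling: let $T$ be a Schröder tree with $n$ leaves and let $m\ge n-1$. Label the vertices one after the other in post-order: (1) if $v$ is the leftmost child of $w$, where $w$ is the root of the subtree $(w,(T_1,\dots,T_k))$ and $v$ is the root of $T_1$, then $\lambda(v)$ is the total number of leaves of $T_2,\dots,T_k$; (2) if $v$ is not the leftmost child of a vertex, then $\lambda(v)=m-\sum_{w\in LD(v)}\lambda(w)$, where $LD(v)$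 is the set of leftmost descendants of $v$: the leftmost child of $v$, its leftmost child, and so on (empty if $v$ is a leaf). All labels are positive except that the root may have label $0$. $\Phi_m(T)$ is the word obtained by reading the labels of $T$ in post-order and replacing each label $i$ by $\rho_i$. Local move: suppose a Schröder tree $T$ has a subtree $T_1$ with root $r_1$ such that $r_1$ is not the root of $T$ (let $r_0$ be its parent), $r_1$ has exactly two children, so $T_1=(r_1,(A_1,A_2))$, and $A_2$ is a single leaf. Contract the edge $r_0 - r_1$, i.e. if the subtree rooted at $r_0$ is $(r_0,(S_1,\dots,S_k,T_1,S_{k+2},\dots,S_r))$, replace it by $(r_0,(S_1,\dots,S_k,A_1,A_2,S_{k+2},\dots,S_r))$. This transformation, or its inverse, is called a local move. *)

theory Defs
  imports "HOL-Algebra.Group"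
begin

section \<open>Monoid presentations and the monoids \<open>M m\<close>\<close>

definition rel_step :: "'a set \<Rightarrow> ('a list \<times> 'a list) set \<Rightarrow> ('a list \<times> 'a list) set" where
  "rel_step A R = {(u @ l @ v, u @ r @ v) | u v l r.
     u \<in> lists A \<and> v \<in> lists A \<and> (l, r) \<in> R}"

text \<open>The congruence on the free monoid of lists over \<open>A\<close> generated by \<open>R\<close>.\<close>

definition pres_cong :: "'a set \<Rightarrow> ('a list \<times> 'a list) set \<Rightarrow> ('a list \<times> 'a list) set" where
  "pres_cong A R =
     (rel_step A R \<union> (rel_step A R)\<inverse>)\<^sup>* \<inter> lists A \<times> lists A"

definition presented_monoid :: "'a set \<Rightarrow> ('a list \<times> 'a list) set \<Rightarrow> 'a list set monoid" where
  "presented_monoid A R =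
     \<lparr>carrier = lists A // pres_cong A R,
      monoid.mult = (\<lambda>X Y. \<Union>x\<in>X. \<Union>y\<in>Y. pres_cong A R `` {x @ y}),
      one = pres_cong A R `` {[]}\<rparr>"

definition M_rels :: "nat \<Rightarrow> (nat list \<times> nat list) set" where
  "M_rels m = {([1, m, i], [i + 1, m]) | i. 1 \<le> i \<and> i \<le> m - 1}"

definition M :: "nat \<Rightarrow> nat list set monoid" where
  "M m = presented_monoid {1..m} (M_rels m)"

definition rho :: "nat \<Rightarrow> nat \<Rightarrow> nat list set" where
  "rho m i = (if i = 0 then \<one>\<^bsub>M m\<^esub> else pres_cong {1..m} (M_rels m) `` {[i]})"

definition words_for :: "nat \<Rightarrow> nat list set \<Rightarrow> nat list set" where
  "words_for m x =
     {w \<in> lists {1..m}. foldr (\<lambda>i y. rho m i \<otimes>\<^bsub>M m\<^esub> y) w \<one>\<^bsub>M m\<^esub> = x}"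

lemma equiv_pres_cong: "equiv (lists A) (pres_cong A R)"
proof -
  let ?S = "rel_step A R \<union> (rel_step A R)\<inverse>"
  have "sym (?S\<^sup>*)"
    by (intro sym_rtrancl symI) auto
  then show ?thesis
    unfolding pres_cong_def
    by (intro equivI refl_onI symI transI) (auto dest: symD)
qed

lemma pres_cong_append:
  assumes "(x, x') \<in> pres_cong A R" "(y, y') \<in> pres_cong A R"
  shows "(x @ y, x' @ y') \<in> pres_cong A R"
proof -
  let ?S = "rel_step A R \<union> (rel_step A R)\<inverse>"
  have ctxt: "(a @ p @ b, a @ q @ b) \<in> ?S"
    if "(p, q) \<in> ?S" "a \<in> lists A" "b \<in> lists A" for p q a b
  proof -
    have *: "(a @ p @ b, a @ q @ b) \<in> rel_step A R" if pq: "(p, q) \<in> rel_step A R" for p q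
    proof -
      from pq obtain u v l r where "p = u @ l @ v" "q = u @ r @ v"
        "u \<in> lists A" "v \<in> lists A" "(l, r) \<in> R"
        unfolding rel_step_def by blast
      then have "a @ p @ b = (a @ u) @ l @ (v @ b)" "a @ q @ b = (a @ u) @ r @ (v @ b)"
        "a @ u \<in> lists A" "v @ b \<in> lists A" "(l, r) \<in> R"
        using \<open>a \<in> lists A\<close> \<open>b \<in> lists A\<close> by auto
      then show ?thesis unfolding rel_step_def by blast
    qed
    show ?thesis using that(1) * by blast
  qed
  have ctxts: "(a @ p @ b, a @ q @ b) \<in> ?S\<^sup>*"
    if "(p, q) \<in> ?S\<^sup>*" "a \<in> lists A" "b \<in> lists A" for p q a b
    using that(1)
  proof induction
    case base
    show ?case by simp
  next
    case (step q r)
    show ?case using ctxt[OF step.hyps(2) that(2,3)] step.IH by (rule rtrancl_into_rtrancl[rotated])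
  qed
  have "(x @ y, x' @ y) \<in> ?S\<^sup>*" "(x' @ y, x' @ y') \<in> ?S\<^sup>*"
    using ctxts[of x x' "[]" y] ctxts[of y y' x' "[]"] assms
    unfolding pres_cong_def by auto
  then show ?thesis
    using assms unfolding pres_cong_def by auto
qed

lemma presented_monoid_mult_class:
  assumes "x \<in> lists A" "y \<in> lists A"
  shows "(pres_cong A R `` {x}) \<otimes>\<^bsub>presented_monoid A R\<^esub> (pres_cong A R `` {y}) =
           pres_cong A R `` {x @ y}"
proof -
  have "congruent2 (pres_cong A R) (pres_cong A R) (\<lambda>x y. pres_cong A R `` {x @ y})"
    by (intro congruent2I') (auto intro!: equiv_class_eq[OF equiv_pres_cong] pres_cong_append)
  from UN_equiv_class2[OF equiv_pres_cong equiv_pres_cong this assms]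
  show ?thesis by (simp add: presented_monoid_def)
qed

lemma monoid_presented_monoid: "monoid (presented_monoid A R)"
proof -
  let ?P = "presented_monoid A R" and ?c = "\<lambda>x. pres_cong A R `` {x}"
  have carr: "X \<in> carrier ?P \<longleftrightarrow> (\<exists>x\<in>lists A. X = ?c x)" for X
    by (auto simp: presented_monoid_def quotient_def)
  have one: "\<one>\<^bsub>?P\<^esub> = ?c []"
    by (simp add: presented_monoid_def)
  note mult = presented_monoid_mult_class[of _ A _ R]
  show ?thesis
  proof (rule monoidI)
    fix X Y assume "X \<in> carrier ?P" "Y \<in> carrier ?P"
    then obtain x y where "x \<in> lists A" "X = ?c x" "y \<in> lists A" "Y = ?c y"
      unfolding carr by blast
    then show "X \<otimes>\<^bsub>?P\<^esub> Y \<in> carrier ?P"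
      unfolding carr using mult[of x y] append_in_lists_conv[of x y A] by blast
  next
    show "\<one>\<^bsub>?P\<^esub> \<in> carrier ?P"
      unfolding carr one by blast
  next
    fix X Y Z assume "X \<in> carrier ?P" "Y \<in> carrier ?P" "Z \<in> carrier ?P"
    then obtain x y z where "x \<in> lists A" "X = ?c x" "y \<in> lists A" "Y = ?c y"
      "z \<in> lists A" "Z = ?c z"
      unfolding carr by blast
    then show "X \<otimes>\<^bsub>?P\<^esub> Y \<otimes>\<^bsub>?P\<^esub> Z = X \<otimes>\<^bsub>?P\<^esub> (Y \<otimes>\<^bsub>?P\<^esub> Z)"
      by (simp add: mult del: in_lists_conv_set)
  next
    fix X assume "X \<in> carrier ?P"
    then obtain x where "x \<in> lists A" "X = ?c x"
      unfolding carr by blast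
    then show "\<one>\<^bsub>?P\<^esub> \<otimes>\<^bsub>?P\<^esub> X = X" "X \<otimes>\<^bsub>?P\<^esub> \<one>\<^bsub>?P\<^esub> = X"
      unfolding one using mult[of "[]" x] mult[of x "[]"] by simp_all
  qed
qed


section \<open>Rooted plane trees\<close>

text \<open>
  \<open>Leaf\<close> is the empty tree. The degenerate \<open>Node []\<close>, an inner vertex without children,
  is not a Schroeder tree.
\<close>

datatype plane_tree = Leaf | Node "plane_tree list"

fun schroeder :: "plane_tree \<Rightarrow> bool" where
  "schroeder Leaf = True"
| "schroeder (Node ts) = (length ts \<ge> 2 \<and> (\<forall>t\<in>set ts. schroeder t))"

fun leaves :: "plane_tree \<Rightarrow> nat" where
  "leaves Leaf = 1"
| "leaves (Node ts) = sum_list (map leaves ts)"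

text \<open>
  A vertex is represented by its address, the list of (0-based) child indices on the path
  from the root; a leftmost child is a vertex whose address ends in \<open>0\<close>.
\<close>

fun postorder :: "plane_tree \<Rightarrow> nat list list" where
  "postorder Leaf = [[]]"
| "postorder (Node ts) =
     concat (map (\<lambda>(i, vs). map ((#) i) vs) (enumerate 0 (map postorder ts))) @ [[]]"

fun subtree :: "plane_tree \<Rightarrow> nat list \<Rightarrow> plane_tree" where
  "subtree t [] = t"
| "subtree (Node ts) (i # v) = subtree (ts ! i) v"
| "subtree Leaf (i # v) = Leaf"

fun children :: "plane_tree \<Rightarrow> plane_tree list" where
  "children Leaf = []"
| "children (Node ts) = ts"

definition leftmost_child :: "nat list \<Rightarrow> bool" where
  "leftmost_child v \<longleftrightarrow> v \<noteq> [] \<and> last v = 0"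

definition LD :: "plane_tree \<Rightarrow> nat list \<Rightarrow> nat list set" where
  "LD t v = {v @ replicate k 0 | k. k \<ge> 1 \<and> v @ replicate k 0 \<in> set (postorder t)}"

definition leftmost_label :: "plane_tree \<Rightarrow> nat list \<Rightarrow> nat" where
  "leftmost_label t v = sum_list (map leaves (tl (children (subtree t (butlast v)))))"

text \<open>
  For a Schroeder tree with at most \<open>m + 1\<close> leaves the subtraction is never truncated: the sum
  telescopes to one less than the number of leaves below \<open>v\<close>.
\<close>

definition label :: "nat \<Rightarrow> plane_tree \<Rightarrow> nat list \<Rightarrow> nat" where
  "label m t v =
     (if leftmost_child v then leftmost_label t v
      else m - (\<Sum>w\<in>LD t v. leftmost_label t w))"

lemma label_not_leftmost:
  assumes "\<not> leftmost_child v"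
  shows "label m t v = m - (\<Sum>w\<in>LD t v. label m t w)"
proof -
  have "leftmost_child w" if "w \<in> LD t v" for w
    using that by (auto simp: LD_def leftmost_child_def)
  then have "(\<Sum>w\<in>LD t v. leftmost_label t w) = (\<Sum>w\<in>LD t v. label m t w)"
    by (intro sum.cong) (auto simp: label_def)
  with assms show ?thesis by (simp add: label_def)
qed

text \<open>The letter \<open>0\<close> stands for the identity and is deleted.\<close>

definition Phi :: "nat \<Rightarrow> plane_tree \<Rightarrow> nat list" where
  "Phi m t = filter (\<lambda>i. i \<noteq> 0) (map (label m t) (postorder t))"


section \<open>Local moves\<close>

inductive contraction :: "plane_tree \<Rightarrow> plane_tree \<Rightarrow> bool" where
  here: "contraction (Node (ss @ Node [a, Leaf] # ss')) (Node (ss @ a # Leaf # ss'))"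
| below: "contraction t t' \<Longrightarrow> contraction (Node (ss @ t # ss')) (Node (ss @ t' # ss'))"

definition local_move :: "plane_tree \<Rightarrow> plane_tree \<Rightarrow> bool" where
  "local_move t t' \<longleftrightarrow> contraction t t' \<or> contraction t' t"


section \<open>The two graphs\<close>

text \<open>An undirected graph is a pair of a vertex set and a set of unordered pairs of vertices.\<close>

type_synonym 'a graph = "'a set \<times> 'a set set"

definition graph_iso :: "('a \<Rightarrow> 'b) \<Rightarrow> 'a graph \<Rightarrow> 'b graph \<Rightarrow> bool" where
  "graph_iso f G H \<longleftrightarrow>
     bij_betw f (fst G) (fst H) \<and>
     (\<forall>x\<in>fst G. \<forall>y\<in>fst G. {x, y} \<in> snd G \<longleftrightarrow> {f x, f y} \<in> snd H)"

definition adjacency_graph :: "'a set \<Rightarrow> ('a \<Rightarrow> 'a \<Rightarrow> bool) \<Rightarrow> 'a graph" where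
  "adjacency_graph V adj = (V, {{x, y} | x y. x \<in> V \<and> y \<in> V \<and> adj x y})"

definition word_graph :: "nat \<Rightarrow> nat list set \<Rightarrow> nat list graph" where
  "word_graph m x = adjacency_graph (words_for m x)
     (\<lambda>u v. (u, v) \<in> rel_step {1..m} (M_rels m) \<or> (v, u) \<in> rel_step {1..m} (M_rels m))"

definition tree_graph :: "nat \<Rightarrow> plane_tree graph" where
  "tree_graph n = adjacency_graph {t. schroeder t \<and> leaves t = n} local_move"

end

theory Submission
  imports Defs
begin

text \<open>
  For a tree with \<open>m + 1\<close> leaves the root has label \<open>0\<close>, and \<open>Phi m\<close> lists the labels of
  the other vertices. Contracting an edge above a two-child vertex with second child a leaf
  replaces the labels \<open>1, m, i\<close> of its first child, its second child and itself by
  \<open>i + 1, m\<close>. Conversely, apart from the first letter of the word, the letter \<open>m\<close> only arises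
  from a leaf that is not a leftmost child, so its predecessor labels the preceding sibling, and
  every factor \<open>1, m, i\<close> or \<open>i + 1, m\<close> with \<open>i \<ge> 1\<close> comes from a local move. Hence the image
  of \<open>Phi m\<close> is closed under the defining relations; it contains the word \<open>m ... m\<close> of the
  corolla, and collapsing subtrees from the bottom shows that all its words represent the same
  element. Injectivity holds because a word can be parsed from right to left once the number of
  leaves is known.
\<close>

section \<open>Recursive words of trees and their leaf counts\<close>

abbreviation leaf_sum :: "plane_tree list \<Rightarrow> nat" where
  "leaf_sum ts \<equiv> sum_list (map leaves ts)"

text \<open>The labels, in post-order, of all vertices except the root.\<close>

fun nonroot_word :: "nat \<Rightarrow> plane_tree \<Rightarrow> nat list" where
  "nonroot_word m Leaf = []"
| "nonroot_word m (Node []) = []"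
| "nonroot_word m (Node (t # ts)) =
     nonroot_word m t @ leaf_sum ts # concat (map (\<lambda>s. nonroot_word m s @ [m + 1 - leaves s]) ts)"

text \<open>The trees are children other than the leftmost. The labels down the leftmost path below
  the root of \<open>s\<close> sum to \<open>leaves s - 1\<close>, so that root gets
  \<open>m + 1 - leaves s\<close>.\<close>

abbreviation forest_word :: "nat \<Rightarrow> plane_tree list \<Rightarrow> nat list" where
  "forest_word m ts \<equiv> concat (map (\<lambda>s. nonroot_word m s @ [m + 1 - leaves s]) ts)"

text \<open>
  In \<open>Node (ss @ s # ss')\<close>, \<open>prefix_word\<close> is the part of the word contributed by \<open>ss\<close> and
  \<open>child_label\<close> is the label of the root of \<open>s\<close>; they depend on the rest of the tree only through
  numbers of leaves.
\<close>

definition prefix_word :: "nat \<Rightarrow> plane_tree list \<Rightarrow> nat \<Rightarrow> nat list" where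
  "prefix_word m ss c =
     (case ss of [] \<Rightarrow> [] | s # ss' \<Rightarrow> nonroot_word m s @ (leaf_sum ss' + c) # forest_word m ss')"

definition child_label :: "nat \<Rightarrow> plane_tree list \<Rightarrow> nat \<Rightarrow> nat \<Rightarrow> nat" where
  "child_label m ss l c = (if ss = [] then c else m + 1 - l)"

text \<open>Hides whether \<open>s\<close> is the leftmost child. Replacing \<open>s\<close> by a
  tree with as many leaves changes only the factor \<open>nonroot_word m s\<close>.\<close>

lemma nonroot_word_Node_split:
  "nonroot_word m (Node (ss @ s # ss')) =
     prefix_word m ss (leaves s + leaf_sum ss') @ nonroot_word m s @
       child_label m ss (leaves s) (leaf_sum ss') # forest_word m ss'"
  by (cases ss) (auto simp: prefix_word_def child_label_def)

lemma prefix_word_snoc: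
  "prefix_word m (ss @ [a]) c =
     prefix_word m ss (leaves a + c) @ nonroot_word m a @ [child_label m ss (leaves a) c]"
  by (cases ss) (auto simp: prefix_word_def child_label_def add.assoc)

lemma leaves_pos: "schroeder t \<Longrightarrow> leaves t \<ge> 1"
proof (induction t rule: schroeder.induct)
  case (2 ts)
  then obtain t ts' where "ts = t # ts'" by (cases ts) auto
  with 2 have "1 \<le> leaves t" by simp
  with \<open>ts = t # ts'\<close> show ?case by simp
qed simp

lemma length_le_leaf_sum: "\<forall>t\<in>set ts. schroeder t \<Longrightarrow> length ts \<le> leaf_sum ts"
proof (induction ts)
  case (Cons t ts)
  then show ?case using leaves_pos[of t] by auto
qed simp

lemma schroeder_Node_iff:
  "schroeder (Node (ss @ s # ss')) \<longleftrightarrow>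
     (\<forall>t\<in>set ss. schroeder t) \<and> schroeder s \<and> (\<forall>t\<in>set ss'. schroeder t) \<and> ss @ ss' \<noteq> []"
  by (cases ss; cases ss') auto

lemma leaves_child_less:
  assumes "schroeder (Node (ss @ s # ss'))"
  shows "leaves s < leaves (Node (ss @ s # ss'))"
proof -
  have "length ss \<le> leaf_sum ss" "length ss' \<le> leaf_sum ss'"
    using assms length_le_leaf_sum unfolding schroeder_Node_iff by auto
  moreover have "length ss + length ss' > 0"
    using assms unfolding schroeder_Node_iff by simp
  ultimately have "leaf_sum ss + leaf_sum ss' > 0" by linarith
  then show ?thesis by simp
qed

lemma leaves_eq_1_iff: "schroeder t \<Longrightarrow> leaves t = 1 \<longleftrightarrow> t = Leaf"
  using length_le_leaf_sum by (cases t) fastforce+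

lemma schroeder_NodeE:
  assumes "schroeder (Node ts)"
  obtains s ss where "ts = s # ss" "ss \<noteq> []" "schroeder s" "\<forall>t\<in>set ss. schroeder t"
  using assms that by (cases ts) force+

text \<open>At least one leaf of the tree lies outside \<open>s\<close>, so
  \<open>m + 1 - leaves s\<close> is positive; a leftmost \<open>s\<close> has siblings, and its own
  leaves keep their leaf sum at most \<open>m\<close>.\<close>

lemma child_label_bounds:
  assumes "schroeder (Node (ss @ s # ss'))" "leaves (Node (ss @ s # ss')) \<le> m + 1"
  shows "child_label m ss (leaves s) (leaf_sum ss') \<in> {1..m}"
proof -
  have "leaves s \<ge> 1" "length ss' \<le> leaf_sum ss'"
    using assms length_le_leaf_sum leaves_pos unfolding schroeder_Node_iff by auto
  moreover have "leaves s < leaves (Node (ss @ s # ss'))"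
    using assms(1) by (rule leaves_child_less)
  moreover have "ss = [] \<Longrightarrow> ss' \<noteq> []"
    using assms by (auto simp: schroeder_Node_iff)
  ultimately show ?thesis
    using assms(2) by (cases ss') (auto simp: child_label_def)
qed

lemma forest_word_in_lists:
  assumes "\<And>s. s \<in> set ts \<Longrightarrow> nonroot_word m s \<in> lists {1..m}"
    and "\<forall>s\<in>set ts. schroeder s" "\<forall>s\<in>set ts. leaves s \<le> m"
  shows "forest_word m ts \<in> lists {1..m}"
  using assms leaves_pos by (induction ts) (fastforce simp del: One_nat_def)+

lemma leaves_le_leaf_sum: "s \<in> set ts \<Longrightarrow> leaves s \<le> leaf_sum ts"
  by (simp add: member_le_sum_list)

lemma nonroot_word_in_lists:
  "schroeder t \<Longrightarrow> leaves t \<le> m + 1 \<Longrightarrow> nonroot_word m t \<in> lists {1..m}"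
proof (induction m t rule: nonroot_word.induct)
  case (3 m t ts)
  have sch: "schroeder t" "\<forall>s\<in>set ts. schroeder s" using 3 by auto
  have l: "leaves t \<ge> 1" using sch leaves_pos by auto
  have "length ts \<le> leaf_sum ts" using sch length_le_leaf_sum by auto
  moreover have "ts \<noteq> []" using 3 by auto
  ultimately have q: "leaf_sum ts \<in> {1..m}"
    using 3 l by (cases ts) auto
  have le: "leaves s \<le> m" if "s \<in> set ts" for s
    using leaves_le_leaf_sum[OF that] q by simp
  have "nonroot_word m t \<in> lists {1..m}" using 3 sch q by auto
  moreover have "forest_word m ts \<in> lists {1..m}"
    using 3 sch le by (intro forest_word_in_lists) (auto simp: le_Suc_eq)
  ultimately show ?case using q by simp
qed auto

section \<open>Contractions and relation steps\<close>

lemma contraction_leaves: "contraction t t' \<Longrightarrow> leaves t' = leaves t"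
  by (induction rule: contraction.induct) auto

text \<open>\<open>Node [a, Leaf]\<close> and the two siblings \<open>a\<close>, \<open>Leaf\<close>
  cover the same leaves, so all outer labels agree. In the first tree \<open>a\<close> gets 1 for
  the single leaf to its right; the \<open>Leaf\<close> gets \<open>m\<close> in both.\<close>

lemma nonroot_word_contraction_here:
  "nonroot_word m (Node (ss @ Node [a, Leaf] # ss')) =
     (prefix_word m ss (leaves a + 1 + leaf_sum ss') @ nonroot_word m a) @
     [1, m, child_label m ss (leaves a + 1) (leaf_sum ss')] @ forest_word m ss'"
  "nonroot_word m (Node (ss @ a # Leaf # ss')) =
     (prefix_word m ss (leaves a + 1 + leaf_sum ss') @ nonroot_word m a) @
     [child_label m ss (leaves a) (leaf_sum ss' + 1), m] @ forest_word m ss'"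
  by (auto simp: nonroot_word_Node_split)

text \<open>Compares the label of \<open>a\<close>, with \<open>l\<close> leaves, to that of
  \<open>Node [a, Leaf]\<close>: a leftmost child has one more leaf to its right, any other child
  has one leaf fewer below it. The hypothesis rules out truncated subtraction.\<close>

lemma child_label_Suc:
  assumes "child_label m ss (l + 1) c \<ge> 1"
  shows "child_label m ss l (c + 1) = child_label m ss (l + 1) c + 1"
  using assms by (auto simp: child_label_def split: if_splits)

lemma M_rel_stepI:
  assumes "u \<in> lists {1..m}" "v \<in> lists {1..m}" "1 \<le> i" "i < m" "j = i + 1"
  shows "(u @ [1, m, i] @ v, u @ [j, m] @ v) \<in> rel_step {1..m} (M_rels m)"
proof -
  have "([1, m, i], [j, m]) \<in> M_rels m" using assms by (auto simp: M_rels_def)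
  then show ?thesis using assms unfolding rel_step_def by blast
qed

lemma contraction_rel_step:
  assumes "contraction t t'" "schroeder t" "leaves t \<le> m + 1"
  shows "(nonroot_word m t, nonroot_word m t') \<in> rel_step {1..m} (M_rels m)"
  using assms
proof (induction rule: contraction.induct)
  case (here ss a ss')
  let ?u = "prefix_word m ss (leaves a + 1 + leaf_sum ss') @ nonroot_word m a"
  let ?i = "child_label m ss (leaves a + 1) (leaf_sum ss')"
  have i: "?i \<in> {1..m}"
    using child_label_bounds[OF here] by simp
  \<comment> \<open>The relations need \<open>i < m\<close>. For a leftmost child,
    \<open>?i = m\<close> would give more than \<open>m + 1\<close> leaves in all; for another child
    it would force \<open>leaves a = 0\<close>.\<close>
  have "?i \<noteq> m"
  proof
    assume im: "?i = m"
    have "length ss' \<le> leaf_sum ss'" "leaves a \<ge> 1"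
      using here length_le_leaf_sum leaves_pos unfolding schroeder_Node_iff by auto
    then show False using im i here(2) by (auto simp: child_label_def split: if_splits)
  qed
  moreover have "nonroot_word m (Node (ss @ Node [a, Leaf] # ss')) \<in> lists {1..m}"
    using nonroot_word_in_lists here by blast
  ultimately show ?case
    using i child_label_Suc[of m ss "leaves a" "leaf_sum ss'"]
    unfolding nonroot_word_contraction_here
    by (intro M_rel_stepI) (auto simp del: in_lists_conv_set)
next
  case (below t t' ss ss')
  have len: "leaves t' = leaves t" using below contraction_leaves by blast
  have "(nonroot_word m t, nonroot_word m t') \<in> rel_step {1..m} (M_rels m)"
    using below leaves_child_less[OF below.prems(1)] schroeder_Node_iff by auto
  then obtain u v l r where uv: "nonroot_word m t = u @ l @ v" "nonroot_word m t' = u @ r @ v" "(l, r) \<in> M_rels m"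
    unfolding rel_step_def by blast
  have lst: "nonroot_word m (Node (ss @ t # ss')) \<in> lists {1..m}"
    using nonroot_word_in_lists below by blast
  define U where "U = prefix_word m ss (leaves t + leaf_sum ss') @ u"
  define V where "V = v @ child_label m ss (leaves t) (leaf_sum ss') # forest_word m ss'"
  have e: "nonroot_word m (Node (ss @ t # ss')) = U @ l @ V" "nonroot_word m (Node (ss @ t' # ss')) = U @ r @ V"
    unfolding nonroot_word_Node_split U_def V_def using uv len by simp_all
  then have "U \<in> lists {1..m}" "V \<in> lists {1..m}" using lst by auto
  then show ?case using e uv(3) unfolding rel_step_def by blast
qed

section \<open>Locating letters and factors in the word of a tree\<close>

lemma forest_word_eq_append_Cons:
  assumes "forest_word m ts = u @ y # v"
  obtains ss s ss' x x' where "ts = ss @ s # ss'" "nonroot_word m s = x @ y # x'"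
      "u = forest_word m ss @ x" "v = x' @ (m + 1 - leaves s) # forest_word m ss'"
  | ss s ss' where "ts = ss @ s # ss'" "y = m + 1 - leaves s" "u = forest_word m ss @ nonroot_word m s"
      "v = forest_word m ss'"
proof -
  have "(\<exists>ss s ss' x x'. ts = ss @ s # ss' \<and> nonroot_word m s = x @ y # x' \<and>
          u = forest_word m ss @ x \<and> v = x' @ (m + 1 - leaves s) # forest_word m ss') \<or>
        (\<exists>ss s ss'. ts = ss @ s # ss' \<and> y = m + 1 - leaves s \<and> u = forest_word m ss @ nonroot_word m s \<and>
          v = forest_word m ss')" (is "?P ts u \<or> ?Q ts u")
    using assms
  proof (induction ts arbitrary: u)
    case (Cons a ts)
    let ?a = "nonroot_word m a" and ?l = "m + 1 - leaves a"
    have eq: "?a @ ?l # forest_word m ts = u @ y # v" using Cons.prems by simp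
    consider x where "?a = u @ y # x" "v = x @ ?l # forest_word m ts"
      | "?a = u" "y = ?l" "v = forest_word m ts"
      | u' where "u = ?a @ ?l # u'" "forest_word m ts = u' @ y # v"
      using eq by (auto simp: append_eq_append_conv2 append_eq_Cons_conv Cons_eq_append_conv)
    then show ?case
    proof cases
      case 1
      then have "?P (a # ts) u"
        by (intro exI[of _ "[]"] exI[of _ a] exI[of _ ts] exI[of _ u] exI[of _ x]) simp
      then show ?thesis by blast
    next
      case 2
      then have "?Q (a # ts) u"
        by (intro exI[of _ "[]"] exI[of _ a] exI[of _ ts]) simp
      then show ?thesis by blast
    next
      case 3
      from Cons.IH[OF 3(2)] show ?thesis
      proof
        assume "?P ts u'"
        then obtain ss s ss' x x' where "ts = ss @ s # ss'" "nonroot_word m s = x @ y # x'"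
          "u' = forest_word m ss @ x" "v = x' @ (m + 1 - leaves s) # forest_word m ss'" by blast
        then have "?P (a # ts) u" using 3
          by (intro exI[of _ "a # ss"] exI[of _ s] exI[of _ ss'] exI[of _ x] exI[of _ x']) simp
        then show ?thesis by blast
      next
        assume "?Q ts u'"
        then obtain ss s ss' where "ts = ss @ s # ss'" "y = m + 1 - leaves s"
          "u' = forest_word m ss @ nonroot_word m s" "v = forest_word m ss'" by blast
        then have "?Q (a # ts) u" using 3
          by (intro exI[of _ "a # ss"] exI[of _ s] exI[of _ ss']) simp
        then show ?thesis by blast
      qed
    qed
  qed simp
  then show ?thesis using that by blast
qed

lemma nonroot_word_Node_eq_append_Cons:
  assumes "nonroot_word m (Node ts) = u @ y # v"
  obtains
    (inside) ss s ss' x x' where "ts = ss @ s # ss'" "nonroot_word m s = x @ y # x'"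
      "u = prefix_word m ss (leaves s + leaf_sum ss') @ x"
      "v = x' @ child_label m ss (leaves s) (leaf_sum ss') # forest_word m ss'"
  | (label) ss s ss' where "ts = ss @ s # ss'" "y = child_label m ss (leaves s) (leaf_sum ss')"
      "u = prefix_word m ss (leaves s + leaf_sum ss') @ nonroot_word m s" "v = forest_word m ss'"
proof -
  obtain a ts' where ts: "ts = a # ts'" using assms by (cases ts) auto
  let ?a = "nonroot_word m a" and ?l = "leaf_sum ts'"
  have eq: "?a @ ?l # forest_word m ts' = u @ y # v" using assms ts by simp
  consider x where "?a = u @ y # x" "v = x @ ?l # forest_word m ts'"
    | "?a = u" "y = ?l" "v = forest_word m ts'"
    | u' where "u = ?a @ ?l # u'" "forest_word m ts' = u' @ y # v"
    using eq by (auto simp: append_eq_append_conv2 append_eq_Cons_conv Cons_eq_append_conv)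
  then show ?thesis
  proof cases
    case 1
    show ?thesis
      by (rule inside[of "[]" a ts' u x]) (use 1 ts in \<open>auto simp: prefix_word_def child_label_def\<close>)
  next
    case 2
    show ?thesis
      by (rule label[of "[]" a ts']) (use 2 ts in \<open>auto simp: prefix_word_def child_label_def\<close>)
  next
    case 3
    from 3(2) show ?thesis
    proof (cases rule: forest_word_eq_append_Cons)
      case (1 ss s ss' x x')
      show ?thesis
        by (rule inside[of "a # ss" s ss' x x'])
          (use 1 3 ts in \<open>auto simp: prefix_word_def child_label_def\<close>)
    next
      case (2 ss s ss')
      show ?thesis
        by (rule label[of "a # ss" s ss'])
          (use 2 3 ts in \<open>auto simp: prefix_word_def child_label_def\<close>)
    qed
  qed
qed

text \<open>The first letter labels the leftmost leaf and so counts the leaves of its siblings.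
  Hence the word of a subtree with at most \<open>m\<close> leaves does not begin with
  \<open>m\<close>.\<close>

lemma hd_nonroot_word_less:
  "schroeder t \<Longrightarrow> nonroot_word m t = y # v \<Longrightarrow> y < leaves t"
proof (induction m t arbitrary: v rule: nonroot_word.induct)
  case (3 m t ts)
  have sch: "schroeder t" "leaves t \<ge> 1" using 3 leaves_pos by auto
  show ?case
  proof (cases "nonroot_word m t")
    case Nil
    then show ?thesis using 3 sch by auto
  next
    case (Cons z w)
    then have "y < leaves t" using 3 sch by auto
    then show ?thesis by simp
  qed
qed auto

text \<open>A child labelled \<open>m\<close> is a leaf, and it is not the leftmost child because a
  letter precedes it; that letter labels the preceding sibling. Any other \<open>m\<close> lies in
  the word of a child together with its predecessor.\<close>

lemma nonroot_word_Node_factor: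
  assumes "nonroot_word m (Node ts) = u @ p # m # v" "schroeder (Node ts)" "leaves (Node ts) \<le> m + 1"
  obtains
    (inside) ss s ss' x x' where "ts = ss @ s # ss'" "nonroot_word m s = x @ p # m # x'"
      "u = prefix_word m ss (leaves s + leaf_sum ss') @ x"
      "v = x' @ child_label m ss (leaves s) (leaf_sum ss') # forest_word m ss'"
  | (siblings) ss a ss' where "ts = ss @ a # Leaf # ss'"
      "p = child_label m ss (leaves a) (leaf_sum ss' + 1)"
      "u = prefix_word m ss (leaves a + 1 + leaf_sum ss') @ nonroot_word m a" "v = forest_word m ss'"
proof -
  have "nonroot_word m (Node ts) = (u @ [p]) @ m # v" using assms by simp
  then show ?thesis
  proof (cases rule: nonroot_word_Node_eq_append_Cons)
    case C: (inside ss s ss' x x')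
    have s: "schroeder s" "leaves s \<le> m"
      using assms C leaves_child_less[of ss s ss'] schroeder_Node_iff by auto
    with C hd_nonroot_word_less[of s m m x'] have "x \<noteq> []" by auto
    then obtain x0 where "x = x0 @ [p]" "u = prefix_word m ss (leaves s + leaf_sum ss') @ x0"
      using C(3) by (cases x rule: rev_cases) auto
    with C show ?thesis using inside by auto
  next
    case C: (label ss s ss')
    have sch: "schroeder (Node (ss @ s # ss'))" "leaves (Node (ss @ s # ss')) \<le> m + 1"
      using assms C by auto
    have s: "schroeder s" "leaves s \<ge> 1" using sch leaves_pos unfolding schroeder_Node_iff by auto
    \<comment> \<open>A leftmost \<open>s\<close> has \<open>m\<close> leaves to its right out of at
      most \<open>m + 1\<close>; any other \<open>s\<close> satisfies
      \<open>m + 1 - leaves s = m\<close>.\<close>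
    have "leaves s = 1"
    proof (cases "ss = []")
      case True
      then show ?thesis using C(2) sch s by (simp add: child_label_def)
    next
      case False
      then show ?thesis using C(2) s leaves_child_less[OF sch(1)] sch(2)
        by (simp add: child_label_def)
    qed
    then have leaf: "s = Leaf" using s leaves_eq_1_iff by blast
    \<comment> \<open>A leftmost leaf is visited first, leaving no place for
      \<open>p\<close>.\<close>
    then obtain ss0 a where ss: "ss = ss0 @ [a]"
      using C(3) by (cases ss rule: rev_cases) (auto simp: prefix_word_def)
    show ?thesis
      by (rule siblings[of ss0 a ss']) (use C ss leaf in \<open>auto simp: prefix_word_snoc\<close>)
  qed
qed

text \<open>Were \<open>a\<close> not leftmost, it would have \<open>m\<close> leaves, and with
  \<open>Leaf\<close> and an earlier sibling the total would exceed \<open>m + 1\<close>. As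
  leftmost child it has one leaf to its right, the \<open>Leaf\<close>.\<close>

lemma child_label_eq_1D:
  assumes "child_label m ss (leaves a) (leaf_sum ss' + 1) = 1"
    and "schroeder (Node (ss @ a # Leaf # ss'))" "leaves (Node (ss @ a # Leaf # ss')) \<le> m + 1"
  shows "ss = []" "ss' = []"
proof -
  have len: "length ss \<le> leaf_sum ss" "length ss' \<le> leaf_sum ss'"
    using assms(2) length_le_leaf_sum unfolding schroeder_Node_iff by auto
  show "ss = []"
  proof (rule ccontr)
    assume "ss \<noteq> []"
    then show False using assms(1,3) len by (cases ss) (auto simp: child_label_def)
  qed
  then have "leaf_sum ss' = 0" using assms(1) by (simp add: child_label_def)
  then have "length ss' = 0" using len by linarith
  then show "ss' = []" by simp
qed

text \<open>Recognizes a subtree that can be contracted: \<open>m\<close> labels its last child, a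
  leaf, and the letter 1 excludes further children.\<close>

lemma nonroot_word_ends_1_m:
  assumes "nonroot_word m s = x @ [1, m]" "schroeder s" "leaves s \<le> m"
  obtains a where "s = Node [a, Leaf]" "x = nonroot_word m a"
proof -
  obtain ts where s: "s = Node ts" using assms by (cases s) auto
  have "nonroot_word m (Node ts) = x @ 1 # m # []" "schroeder (Node ts)" "leaves (Node ts) \<le> m + 1"
    using assms s by simp_all
  then show ?thesis
  proof (cases rule: nonroot_word_Node_factor)
    case (siblings ss a ss')
    have "ss = []" "ss' = []"
      using child_label_eq_1D[OF siblings(2)[symmetric]] siblings(1) assms(2,3) s by simp_all
    with siblings(1,3) s that show ?thesis by (simp add: prefix_word_def)
  qed (use assms s in auto)
qed

section \<open>Lifting relation steps to contractions\<close>

text \<open>Descends to the vertex where \<open>1, m\<close> ends the word of a child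
  \<open>s\<close>; then \<open>i\<close> labels the root of \<open>s\<close>, and \<open>s\<close>
  is the subtree to contract.\<close>

lemma contract_factor:
  assumes "nonroot_word m t = u @ [1, m, i] @ v" "schroeder t" "leaves t \<le> m + 1"
  shows "\<exists>t'. contraction t t' \<and> schroeder t' \<and> nonroot_word m t' = u @ [i + 1, m] @ v"
  using assms
proof (induction t arbitrary: u v)
  case (Node ts)
  have "nonroot_word m (Node ts) = u @ 1 # m # i # v" using Node.prems by simp
  then show ?case using Node.prems(2,3)
  proof (cases rule: nonroot_word_Node_factor)
    case C: (inside ss s ss' x x')
    let ?P = "prefix_word m ss (leaves s + leaf_sum ss')"
    let ?l = "child_label m ss (leaves s) (leaf_sum ss')"
    have sch: "schroeder (Node (ss @ s # ss'))" "leaves (Node (ss @ s # ss')) \<le> m + 1"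
      using Node.prems C by auto
    then have s: "schroeder s" "leaves s \<le> m"
      using leaves_child_less[OF sch(1)] schroeder_Node_iff by auto
    show ?thesis
    proof (cases x')
      case Nil
      then have i: "i = ?l" "v = forest_word m ss'" using C by auto
      have "nonroot_word m s = x @ [1, m]" using C Nil by simp
      from this s obtain a where a: "s = Node [a, Leaf]" "x = nonroot_word m a"
        by (rule nonroot_word_ends_1_m)
      have "?l \<ge> 1" using child_label_bounds[OF sch] by simp
      then have "child_label m ss (leaves a) (leaf_sum ss' + 1) = i + 1"
        using child_label_Suc[of m ss "leaves a" "leaf_sum ss'"] i a by simp
      then have "nonroot_word m (Node (ss @ a # Leaf # ss')) = u @ [i + 1, m] @ v"
        unfolding nonroot_word_contraction_here using C i a by simp
      moreover have "contraction (Node ts) (Node (ss @ a # Leaf # ss'))"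
        using C a contraction.here by simp
      moreover have "schroeder (Node (ss @ a # Leaf # ss'))"
        using sch a unfolding schroeder_Node_iff by auto
      ultimately show ?thesis by blast
    next
      case (Cons j x'')
      then have x: "j = i" "nonroot_word m s = x @ [1, m, i] @ x''" "v = x'' @ ?l # forest_word m ss'"
        using C by auto
      have "s \<in> set ts" using C by simp
      from Node.IH[OF this x(2) s(1)] s(2) obtain s' where s': "contraction s s'" "schroeder s'"
        "nonroot_word m s' = x @ [i + 1, m] @ x''" by auto
      have len: "leaves s' = leaves s" using s'(1) by (rule contraction_leaves)
      have "nonroot_word m (Node (ss @ s' # ss')) = u @ [i + 1, m] @ v"
        using s' len C x by (simp add: nonroot_word_Node_split)
      moreover have "contraction (Node ts) (Node (ss @ s' # ss'))"
        using C s' contraction.below by simp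
      moreover have "schroeder (Node (ss @ s' # ss'))"
        using sch s' unfolding schroeder_Node_iff by auto
      ultimately show ?thesis by blast
    qed
  next
    case (siblings ss a ss')
    \<comment> \<open>Then \<open>1, m\<close> would end the whole word, but \<open>i\<close>
      follows.\<close>
    have "ss' = []"
      using child_label_eq_1D(2)[OF siblings(2)[symmetric]] siblings(1) Node.prems(2,3) by simp
    with siblings(4) show ?thesis by simp
  qed
qed simp

text \<open>The letters \<open>i + 1, m\<close> label neighbouring siblings \<open>a\<close> and
  \<open>Leaf\<close>, which are put under a new vertex labelled \<open>i\<close>.\<close>

lemma expand_factor:
  assumes "nonroot_word m t = u @ [i + 1, m] @ v" "i \<ge> 1" "schroeder t" "leaves t \<le> m + 1"
  shows "\<exists>t'. contraction t' t \<and> schroeder t' \<and> nonroot_word m t' = u @ [1, m, i] @ v"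
  using assms
proof (induction t arbitrary: u v)
  case (Node ts)
  have "nonroot_word m (Node ts) = u @ (i + 1) # m # v" using Node.prems by simp
  then show ?case using Node.prems(3,4)
  proof (cases rule: nonroot_word_Node_factor)
    case C: (inside ss s ss' x x')
    have sch: "schroeder (Node (ss @ s # ss'))" "leaves (Node (ss @ s # ss')) \<le> m + 1"
      using Node.prems C by auto
    then have s: "schroeder s" "leaves s \<le> m"
      using leaves_child_less[OF sch(1)] schroeder_Node_iff by auto
    have "s \<in> set ts" "nonroot_word m s = x @ [i + 1, m] @ x'" using C by auto
    from Node.IH[OF this Node.prems(2) s(1)] s(2) obtain s' where s': "contraction s' s"
      "schroeder s'" "nonroot_word m s' = x @ [1, m, i] @ x'" by auto
    have len: "leaves s = leaves s'" using s'(1) by (rule contraction_leaves)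
    have "nonroot_word m (Node (ss @ s' # ss')) = u @ [1, m, i] @ v"
      using s' len C by (simp add: nonroot_word_Node_split)
    moreover have "contraction (Node (ss @ s' # ss')) (Node ts)"
      using C s' contraction.below by simp
    moreover have "schroeder (Node (ss @ s' # ss'))"
      using sch s' unfolding schroeder_Node_iff by auto
    ultimately show ?thesis by blast
  next
    case (siblings ss a ss')
    have sch: "schroeder (Node (ss @ a # Leaf # ss'))" using Node.prems siblings by simp
    \<comment> \<open>Without a further sibling the expansion would create a one-child vertex; but
      then \<open>a\<close> would have label 1, against \<open>i \<ge> 1\<close>.\<close>
    have "ss @ ss' \<noteq> []"
      using siblings(2) Node.prems(2) by (auto simp: child_label_def)
    then have "schroeder (Node (ss @ Node [a, Leaf] # ss'))"
      using sch unfolding schroeder_Node_iff by auto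
    moreover have "contraction (Node (ss @ Node [a, Leaf] # ss')) (Node ts)"
      using siblings contraction.here by simp
    moreover have "child_label m ss (leaves a + 1) (leaf_sum ss') = i"
      using siblings(2) by (auto simp: child_label_def split: if_splits)
    then have "nonroot_word m (Node (ss @ Node [a, Leaf] # ss')) = u @ [1, m, i] @ v"
      unfolding nonroot_word_contraction_here using siblings by simp
    ultimately show ?thesis by blast
  qed
qed simp

section \<open>Unique parsing\<close>

text \<open>
  The last letter tells whether it labels the leftmost child (then it is \<open>c\<close>) or the root of the
  last tree \<open>s\<close> (then it is \<open>m + 1 - leaves s\<close>): both at once would need more than \<open>m + 1\<close>
  leaves. Here \<open>c\<close> counts the leaves of the siblings that have already been read.
\<close>

lemma forest_word_cancel:
  assumes "u @ nonroot_word m a @ (leaf_sum ss + c) # forest_word m ss =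
      u' @ nonroot_word m a' @ (leaf_sum ss' + c) # forest_word m ss'"
    and "leaves a + leaf_sum ss = leaves a' + leaf_sum ss'"
    and "leaves a + leaf_sum ss + c \<le> m + 1"
    and "schroeder a" "\<forall>s\<in>set ss. schroeder s" "schroeder a'" "\<forall>s\<in>set ss'. schroeder s"
    and "\<And>s s' v v'. s \<in> set (a # ss) \<Longrightarrow> schroeder s' \<Longrightarrow> leaves s = leaves s' \<Longrightarrow>
      v @ nonroot_word m s = v' @ nonroot_word m s' \<Longrightarrow> v = v' \<and> s = s'"
  shows "u = u' \<and> a = a' \<and> ss = ss'"
  using assms
proof (induction ss arbitrary: u u' c ss' rule: rev_induct)
  case Nil
  have pos: "leaves a' \<ge> 1" using Nil.prems leaves_pos by blast
  show ?case
  proof (cases ss' rule: rev_cases)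
    case Nil
    then have "u @ nonroot_word m a = u' @ nonroot_word m a'" "leaves a = leaves a'" using Nil.prems(1,2) by auto
    then have "u = u' \<and> a = a'" using Nil.prems(6,8) by simp
    with Nil show ?thesis by simp
  next
    case (snoc ss0 s0)
    then have "c = m + 1 - leaves s0" using Nil.prems(1) by simp
    then show ?thesis using Nil.prems(2,3) snoc pos by simp
  qed
next
  case (snoc s ss)
  have pos: "leaves a \<ge> 1" using snoc.prems leaves_pos by blast
  show ?case
  proof (cases ss' rule: rev_cases)
    case Nil
    then have "c = m + 1 - leaves s" using snoc.prems(1) by simp
    then show ?thesis using snoc.prems(2,3) Nil pos by simp
  next
    case C: (snoc ss0 s0)
    have "m + 1 - leaves s = m + 1 - leaves s0" using snoc.prems(1) C by simp
    moreover have "leaves s \<le> m + 1" "leaves s0 \<le> m + 1" using snoc.prems(2,3) C by auto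
    ultimately have l: "leaves s = leaves s0" by linarith
    \<comment> \<open>The leaves of \<open>s\<close> now count as already read, so \<open>c\<close>
      grows by \<open>leaves s\<close>.\<close>
    have "(u @ nonroot_word m a @ (leaf_sum ss + (c + leaves s)) # forest_word m ss) @ nonroot_word m s =
        (u' @ nonroot_word m a' @ (leaf_sum ss0 + (c + leaves s)) # forest_word m ss0) @ nonroot_word m s0"
      using snoc.prems(1) C l by (simp add: ac_simps)
    moreover have "s \<in> set (a # ss @ [s])" "schroeder s0" using snoc.prems(7) C by auto
    ultimately have *: "u @ nonroot_word m a @ (leaf_sum ss + (c + leaves s)) # forest_word m ss =
        u' @ nonroot_word m a' @ (leaf_sum ss0 + (c + leaves s)) # forest_word m ss0 \<and> s = s0"
      using snoc.prems(8) l by blast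
    have "u = u' \<and> a = a' \<and> ss = ss0"
    proof (rule snoc.IH[OF conjunct1[OF *]])
      show "leaves a + leaf_sum ss = leaves a' + leaf_sum ss0"
        using snoc.prems(2) C l by simp
      show "leaves a + leaf_sum ss + (c + leaves s) \<le> m + 1"
        using snoc.prems(3) by simp
      show "v = v' \<and> x = x'" if "x \<in> set (a # ss)" "schroeder x'" "leaves x = leaves x'"
        "v @ nonroot_word m x = v' @ nonroot_word m x'" for x x' v v'
        using snoc.prems(8)[OF _ that(2-4)] that(1) by auto
    qed (use snoc.prems(4-7) C in simp_all)
    then show ?thesis using * C by simp
  qed
qed

text \<open>The prefixes stand for letters not yet read from the right; injectivity is the case of
  empty prefixes. Equal numbers of leaves tell where the word of the tree begins.\<close>

lemma nonroot_word_cancel: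
  assumes "u @ nonroot_word m t = u' @ nonroot_word m t'" "schroeder t" "schroeder t'"
    and "leaves t = leaves t'" "leaves t \<le> m + 1"
  shows "u = u' \<and> t = t'"
  using assms
proof (induction t arbitrary: t' u u')
  case Leaf
  then have "leaves t' = 1" by simp
  then have "t' = Leaf" using leaves_eq_1_iff Leaf by blast
  then show ?case using Leaf by simp
next
  case (Node ts)
  have "t' \<noteq> Leaf" using Node.prems leaves_eq_1_iff[of "Node ts"] by auto
  then obtain ts' where t': "t' = Node ts'" by (cases t') auto
  obtain a ss where ts: "ts = a # ss" using Node.prems by (cases ts) auto
  obtain a' ss' where ts': "ts' = a' # ss'" using Node.prems t' by (cases ts') auto
  have "u = u' \<and> a = a' \<and> ss = ss'"
  proof (rule forest_word_cancel[where c = 0])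
    fix s s' v v'
    assume s: "s \<in> set (a # ss)" "schroeder s'" "leaves s = leaves s'"
      "v @ nonroot_word m s = v' @ nonroot_word m s'"
    then have "leaves s \<le> leaf_sum ts" using leaves_le_leaf_sum ts by blast
    then show "v = v' \<and> s = s'"
      using Node.IH[of s v v' s'] s Node.prems ts by auto
  qed (use Node.prems ts t' ts' in auto)
  then show ?case using ts t' ts' by simp
qed

section \<open>The element represented by a tree\<close>

lemma M_congI:
  "1 \<le> i \<Longrightarrow> i < m \<Longrightarrow> ([1, m, i], [i + 1, m]) \<in> pres_cong {1..m} (M_rels m)"
  using M_rel_stepI[of "[]" m "[]" i "i + 1"] unfolding pres_cong_def by auto

lemma M_cong_refl: "w \<in> lists {1..m} \<Longrightarrow> (w, w) \<in> pres_cong {1..m} (M_rels m)"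
  unfolding pres_cong_def by auto

lemma M_cong_trans [trans]:
  "(u, v) \<in> pres_cong A R \<Longrightarrow> (v, w) \<in> pres_cong A R \<Longrightarrow> (u, w) \<in> pres_cong A R"
  unfolding pres_cong_def by auto

lemma M_cong_sym: "(u, v) \<in> pres_cong A R \<Longrightarrow> (v, u) \<in> pres_cong A R"
  using equiv_pres_cong unfolding equiv_def sym_def by blast

text \<open>By induction, \<open>k + 1, m\<close> is expanded to \<open>1, m, k\<close>, the inner
  \<open>k\<close> absorbs \<open>j\<close>, and \<open>1, m, j + k\<close> is contracted. The bound
  keeps the indices in the range of the relations.\<close>

lemma M_cong_collect:
  assumes "1 \<le> k" "1 \<le> j" "j + k \<le> m"
  shows "(k # replicate k m @ [j], (j + k) # replicate k m) \<in> pres_cong {1..m} (M_rels m)"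
  using assms
proof (induction k rule: nat_induct_at_least)
  case base
  then show ?case using M_congI[of j m] by simp
next
  case (Suc k)
  let ?C = "pres_cong {1..m} (M_rels m)"
  have "([k + 1, m] @ (replicate k m @ [j]), [1, m, k] @ (replicate k m @ [j])) \<in> ?C"
    using Suc by (intro pres_cong_append M_cong_sym[OF M_congI] M_cong_refl) auto
  also have "([1, m] @ (k # replicate k m @ [j]), [1, m] @ ((j + k) # replicate k m)) \<in> ?C"
    using Suc by (intro pres_cong_append M_cong_refl Suc.IH) auto
  then have "([1, m, k] @ (replicate k m @ [j]), [1, m, j + k] @ replicate k m) \<in> ?C" by simp
  also have "([1, m, j + k] @ replicate k m, [j + k + 1, m] @ replicate k m) \<in> ?C"
    using Suc by (intro pres_cong_append M_congI M_cong_refl) auto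
  finally show ?case by simp
qed

lemma forest_word_cong:
  assumes "\<And>s. s \<in> set ss \<Longrightarrow>
      (nonroot_word m s @ [m + 1 - leaves s], replicate (leaves s) m) \<in> pres_cong {1..m} (M_rels m)"
  shows "(forest_word m ss, replicate (leaf_sum ss) m) \<in> pres_cong {1..m} (M_rels m)"
  using assms
proof (induction ss)
  case Nil
  show ?case using M_cong_refl[of "[]" m] by simp
next
  case (Cons s ss)
  have "((nonroot_word m s @ [m + 1 - leaves s]) @ forest_word m ss,
      replicate (leaves s) m @ replicate (leaf_sum ss) m) \<in> pres_cong {1..m} (M_rels m)"
    using Cons by (intro pres_cong_append) auto
  then show ?case by (simp add: replicate_add)
qed

text \<open>Every tree other than \<open>Leaf\<close> collapses to the corolla with as many leaves.
  The version with a trailing \<open>j\<close>, obtained from \<open>M_cong_collect\<close> with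
  \<open>k = leaves t - 1\<close>, absorbs the label of the root, as needed for the
  children.\<close>

lemma nonroot_word_cong:
  assumes "schroeder t" "leaves t \<le> m + 1"
  shows "t \<noteq> Leaf \<Longrightarrow> (nonroot_word m t, (leaves t - 1) # replicate (leaves t - 1) m)
           \<in> pres_cong {1..m} (M_rels m)" (is "_ \<Longrightarrow> ?P t")
    and "1 \<le> j \<Longrightarrow> j + leaves t \<le> m + 1 \<Longrightarrow>
           (nonroot_word m t @ [j], (j + leaves t - 1) # replicate (leaves t - 1) m)
             \<in> pres_cong {1..m} (M_rels m)" (is "_ \<Longrightarrow> _ \<Longrightarrow> ?Q t j")
proof -
  let ?C = "pres_cong {1..m} (M_rels m)"
  have "(t \<noteq> Leaf \<longrightarrow> ?P t) \<and> (\<forall>j. 1 \<le> j \<longrightarrow> j + leaves t \<le> m + 1 \<longrightarrow> ?Q t j)"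
    using assms
  proof (induction t)
    case Leaf
    then show ?case by (auto intro!: M_cong_refl simp del: One_nat_def)
  next
    case (Node ts)
    obtain a ss where ts: "ts = a # ss" and ss: "ss \<noteq> []" "schroeder a" "\<forall>s\<in>set ss. schroeder s"
      using Node.prems(1) by (rule schroeder_NodeE)
    let ?l = "leaves (Node ts)"
    have pos: "leaves a \<ge> 1" "leaf_sum ss \<ge> 1"
      using ss leaves_pos length_le_leaf_sum[of ss] by (simp, cases ss) auto
    have less: "leaves s \<le> m" if "s \<in> set ts" for s
    proof -
      obtain xs ys where "ts = xs @ s # ys" using \<open>s \<in> set ts\<close> by (meson split_list)
      then show ?thesis using leaves_child_less[of xs s ys] Node.prems by auto
    qed
    have IH: "?Q s j" if "s \<in> set ts" "1 \<le> j" "j + leaves s \<le> m + 1" for s j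
      using Node.IH[OF that(1)] that less[OF that(1)] ts ss by auto
    have "?Q a (leaf_sum ss)"
      using IH[of a "leaf_sum ss"] ts pos Node.prems by simp
    \<comment> \<open>With \<open>j = m + 1 - leaves s\<close> the letter
      \<open>j + leaves s - 1\<close> equals \<open>m\<close>.\<close>
    moreover have "(nonroot_word m s @ [m + 1 - leaves s], replicate (leaves s) m) \<in> ?C"
      if s: "s \<in> set ss" for s
    proof -
      have "leaves s \<le> m" "leaves s \<ge> 1" using less ts s ss leaves_pos by auto
      moreover from this have "replicate (leaves s) m = m # replicate (leaves s - 1) m"
        by (cases "leaves s") auto
      ultimately show ?thesis using IH[of s "m + 1 - leaves s"] s ts by simp
    qed
    then have "(forest_word m ss, replicate (leaf_sum ss) m) \<in> ?C" by (rule forest_word_cong)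
    ultimately have "((nonroot_word m a @ [leaf_sum ss]) @ forest_word m ss,
        ((leaf_sum ss + leaves a - 1) # replicate (leaves a - 1) m) @ replicate (leaf_sum ss) m) \<in> ?C"
      by (rule pres_cong_append)
    moreover have "leaves a - 1 + leaf_sum ss = ?l - 1" "leaf_sum ss + leaves a - 1 = ?l - 1"
      using ts pos by auto
    ultimately have P: "?P (Node ts)"
      using ts by (simp flip: replicate_add)
    moreover have "?Q (Node ts) j" if j: "1 \<le> j" "j + ?l \<le> m + 1" for j
    proof -
      have "(nonroot_word m (Node ts) @ [j], ((?l - 1) # replicate (?l - 1) m) @ [j]) \<in> ?C"
        using P j ts pos by (intro pres_cong_append M_cong_refl) auto
      also have "((?l - 1) # replicate (?l - 1) m @ [j], (j + (?l - 1)) # replicate (?l - 1) m) \<in> ?C"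
        using j ts pos by (intro M_cong_collect) auto
      then have "(((?l - 1) # replicate (?l - 1) m) @ [j], (j + ?l - 1) # replicate (?l - 1) m) \<in> ?C"
        using ts pos by (simp add: add.assoc)
      finally show ?thesis .
    qed
    ultimately show ?case by blast
  qed
  then show "t \<noteq> Leaf \<Longrightarrow> ?P t" "1 \<le> j \<Longrightarrow> j + leaves t \<le> m + 1 \<Longrightarrow> ?Q t j" by blast+
qed

section \<open>Labels in post-order\<close>

lemma postorder_snoc: obtains p where "postorder t = p @ [[]]" "[] \<notin> set p"
  by (cases t) auto

lemma Cons_in_postorder_iff:
  "i # v \<in> set (postorder (Node ts)) \<longleftrightarrow> i < length ts \<and> v \<in> set (postorder (ts ! i))"
  by (force simp: in_set_enumerate_eq)

lemma leftmost_label_Cons: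
  "v \<noteq> [] \<Longrightarrow> leftmost_label (Node ts) (i # v) = leftmost_label (ts ! i) v"
  by (simp add: leftmost_label_def)

lemma LD_Cons: "i < length ts \<Longrightarrow> LD (Node ts) (i # v) = (#) i ` LD (ts ! i) v"
  unfolding LD_def by (auto simp: Cons_in_postorder_iff simp del: postorder.simps)

lemma Nil_notin_LD: "[] \<notin> LD t v"
  by (auto simp: LD_def)

lemma sum_LD_Cons:
  assumes "i < length ts"
  shows "(\<Sum>w\<in>LD (Node ts) (i # v). leftmost_label (Node ts) w) =
         (\<Sum>w\<in>LD (ts ! i) v. leftmost_label (ts ! i) w)"
proof -
  have "w \<noteq> []" if "w \<in> LD (ts ! i) v" for w using that Nil_notin_LD by auto
  then show ?thesis
    unfolding LD_Cons[OF assms] by (subst sum.reindex) (auto simp: leftmost_label_Cons)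
qed

text \<open>Telescopes: each leftmost label is the number of leaves lost on stepping down to that
  vertex, and the path ends in a single leaf.\<close>

lemma sum_LD_root:
  "schroeder t \<Longrightarrow> (\<Sum>w\<in>LD t []. leftmost_label t w) = leaves t - 1"
proof (induction t)
  case Leaf
  show ?case by (simp add: LD_def)
next
  case (Node ts)
  obtain a ss where ts: "ts = a # ss" "schroeder a"
    using Node.prems by (rule schroeder_NodeE)
  have "LD (Node ts) [] = insert [0] (LD (Node ts) [0])"
  proof (intro equalityI subsetI)
    fix w assume "w \<in> LD (Node ts) []"
    then obtain k where w: "w = replicate k 0" "k \<ge> 1" "w \<in> set (postorder (Node ts))"
      by (auto simp: LD_def simp del: postorder.simps)
    then obtain k' where k': "k = Suc k'" by (cases k) auto
    show "w \<in> insert [0] (LD (Node ts) [0])"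
    proof (cases k')
      case 0
      then show ?thesis using w k' by simp
    next
      case (Suc l)
      then have "w = [0] @ replicate k' 0" "k' \<ge> 1" using w k' by auto
      then show ?thesis using w(3) unfolding LD_def by blast
    qed
  next
    fix w assume w: "w \<in> insert [0] (LD (Node ts) [0])"
    have "[0] \<in> set (postorder (Node ts))"
      using postorder_snoc[of a] ts by (metis Cons_in_postorder_iff in_set_conv_decomp length_greater_0_conv
          list.distinct(1) nth_Cons_0)
    then have "w \<in> set (postorder (Node ts)) \<and> (\<exists>k\<ge>1. w = replicate k 0)"
      using w unfolding LD_def
      by (auto simp del: postorder.simps intro: exI[of _ "Suc 0"] exI[of _ "Suc _"])
    then show "w \<in> LD (Node ts) []" by (auto simp: LD_def simp del: postorder.simps)
  qed
  moreover have "[0] \<notin> LD (Node ts) [0]" by (auto simp: LD_def)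
  moreover have "finite (LD (Node ts) [0])"
    by (rule finite_subset[of _ "set (postorder (Node ts))"]) (auto simp: LD_def)
  ultimately have "(\<Sum>w\<in>LD (Node ts) []. leftmost_label (Node ts) w) =
      leftmost_label (Node ts) [0] + (\<Sum>w\<in>LD (Node ts) [0]. leftmost_label (Node ts) w)"
    by simp
  also have "\<dots> = leaf_sum ss + (leaves a - 1)"
    using sum_LD_Cons[of 0 ts "[]"] Node.IH[of a] ts by (simp add: leftmost_label_def)
  finally show ?case using ts leaves_pos[of a] by simp
qed

lemma label_root: "schroeder t \<Longrightarrow> label m t [] = m + 1 - leaves t"
  using sum_LD_root[of t] leaves_pos[of t] by (simp add: label_def leftmost_child_def)

text \<open>The exception is \<open>[0]\<close>, a leftmost child in the whole tree but the root of
  its own subtree.\<close>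

lemma label_Cons:
  assumes "i < length ts" "v \<noteq> [] \<or> i \<noteq> 0"
  shows "label m (Node ts) (i # v) = label m (ts ! i) v"
proof (cases "v = []")
  case True
  then show ?thesis using sum_LD_Cons[OF assms(1)] assms(2)
    by (simp add: label_def leftmost_child_def)
next
  case False
  then show ?thesis using sum_LD_Cons[OF assms(1)]
    by (simp add: label_def leftmost_child_def leftmost_label_Cons)
qed

lemma map_label_postorder:
  "schroeder t \<Longrightarrow> map (label m t) (postorder t) = nonroot_word m t @ [m + 1 - leaves t]"
proof (induction t)
  case Leaf
  then show ?case using label_root[of Leaf m] by simp
next
  case (Node ts)
  obtain a ss where ts: "ts = a # ss" and sch: "schroeder a" "\<forall>s\<in>set ss. schroeder s"
    using Node.prems by (rule schroeder_NodeE)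
  let ?L = "label m (Node ts)"
  \<comment> \<open>Only the last entry differs from labelling \<open>a\<close> on its own:
    \<open>leaf_sum ss\<close> replaces \<open>m + 1 - leaves a\<close>.\<close>
  have "map ?L (map ((#) 0) (postorder a)) = nonroot_word m a @ [leaf_sum ss]"
  proof -
    obtain p where p: "postorder a = p @ [[]]" "[] \<notin> set p" by (rule postorder_snoc)
    have "map (label m a) p = nonroot_word m a"
      using Node.IH[of a] ts sch p by simp
    moreover have "?L (0 # v) = label m a v" if "v \<in> set p" for v
      using label_Cons[of 0 ts v m] that p ts by auto
    moreover have "?L [0] = leaf_sum ss"
      using ts by (simp add: label_def leftmost_child_def leftmost_label_def)
    ultimately show ?thesis using p by (simp cong: map_cong)
  qed
  moreover have "map (\<lambda>(i, vs). map ?L (map ((#) i) vs)) (enumerate 1 (map postorder ss)) =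
      map (\<lambda>s. nonroot_word m s @ [m + 1 - leaves s]) ss"
  proof (rule nth_equalityI)
    fix k assume "k < length (map (\<lambda>(i, vs). map ?L (map ((#) i) vs)) (enumerate 1 (map postorder ss)))"
    then have k: "k < length ss" by simp
    then have "map ?L (map ((#) (Suc k)) (postorder (ss ! k))) = map (label m (ss ! k)) (postorder (ss ! k))"
      using label_Cons[of "Suc k" ts _ m] ts by simp
    also have "\<dots> = nonroot_word m (ss ! k) @ [m + 1 - leaves (ss ! k)]"
      using Node.IH[of "ss ! k"] ts sch k by simp
    finally show "map (\<lambda>(i, vs). map ?L (map ((#) i) vs)) (enumerate 1 (map postorder ss)) ! k =
        map (\<lambda>s. nonroot_word m s @ [m + 1 - leaves s]) ss ! k"
      using k by (simp add: nth_enumerate_eq)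
  qed simp
  then have "map ?L (concat (map (\<lambda>(i, vs). map ((#) i) vs) (enumerate 1 (map postorder ss)))) =
      forest_word m ss"
    by (simp add: map_concat comp_def case_prod_unfold)
  ultimately show ?case
    using label_root[OF Node.prems, of m] ts by simp
qed

text \<open>With \<open>m + 1\<close> leaves the root gets 0 and all other labels are positive, so
  the filter removes exactly the letter of the root.\<close>

lemma Phi_eq_nonroot_word:
  assumes "schroeder t" "leaves t = m + 1"
  shows "Phi m t = nonroot_word m t"
proof -
  have "\<forall>i\<in>set (nonroot_word m t). i \<noteq> 0"
    using nonroot_word_in_lists[of t m] assms by auto
  then show ?thesis
    using map_label_postorder[OF assms(1), of m] assms(2) by (simp add: Phi_def)
qed

section \<open>Isomorphism of the two graphs\<close>

abbreviation M_class :: "nat \<Rightarrow> nat list \<Rightarrow> nat list set" where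
  "M_class m w \<equiv> pres_cong {1..m} (M_rels m) `` {w}"

lemma words_for_class:
  assumes "w \<in> lists {1..m}"
  shows "words_for m (M_class m w) = {v. (v, w) \<in> pres_cong {1..m} (M_rels m)}"
proof -
  have eval: "foldr (\<lambda>i y. rho m i \<otimes>\<^bsub>M m\<^esub> y) v \<one>\<^bsub>M m\<^esub> = M_class m v"
    if "v \<in> lists {1..m}" for v
    using that
  proof (induction v)
    case Nil
    show ?case by (simp add: M_def presented_monoid_def)
  next
    case (Cons i v)
    then have "i \<noteq> 0" "[i] \<in> lists {1..m}" "v \<in> lists {1..m}" by auto
    then show ?case
      using Cons.IH presented_monoid_mult_class[of "[i]" "{1..m}" v "M_rels m"]
      by (simp add: rho_def M_def)
  qed
  have "M_class m v = M_class m w \<longleftrightarrow> (v, w) \<in> pres_cong {1..m} (M_rels m)"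
    if "v \<in> lists {1..m}" for v
    using eq_equiv_class_iff[OF equiv_pres_cong that assms] .
  moreover have "v \<in> lists {1..m}" if "(v, w) \<in> pres_cong {1..m} (M_rels m)" for v
    using that unfolding pres_cong_def by blast
  ultimately show ?thesis
    unfolding words_for_def using eval by (intro Collect_cong) metis
qed

lemma rho_pow:
  assumes "m \<ge> 1"
  shows "rho m m [^]\<^bsub>M m\<^esub> k = M_class m (replicate k m)"
proof -
  interpret monoid "M m" unfolding M_def by (rule monoid_presented_monoid)
  show ?thesis
  proof (induction k)
    case 0
    show ?case by (simp add: M_def presented_monoid_def)
  next
    case (Suc k)
    have "replicate k m \<in> lists {1..m}" "[m] \<in> lists {1..m}" using assms by auto
    then have "M_class m (replicate k m) \<otimes>\<^bsub>M m\<^esub> M_class m [m] = M_class m (replicate k m @ [m])"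
      unfolding M_def by (rule presented_monoid_mult_class)
    moreover have "rho m m = M_class m [m]" using assms by (simp add: rho_def)
    ultimately show ?case using Suc by (simp add: replicate_append_same)
  qed
qed

text \<open>For \<open>m = 0\<close> there are no letters and \<open>rho 0 0\<close> is the
  identity, so the power is represented by the empty word.\<close>

definition start_word :: "nat \<Rightarrow> nat list" where
  "start_word m = (if m = 0 then [] else replicate (m + 1) m)"

lemma start_word_in_lists: "start_word m \<in> lists {1..m}"
  by (auto simp: start_word_def)

lemma rho_pow_start_word: "rho m m [^]\<^bsub>M m\<^esub> (m + 1) = M_class m (start_word m)"
proof (cases "m = 0")
  case True
  interpret monoid "M m" unfolding M_def by (rule monoid_presented_monoid)
  have "rho m m = \<one>\<^bsub>M m\<^esub>" using True by (simp add: rho_def)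
  then have "rho m m [^]\<^bsub>M m\<^esub> (m + 1) = \<one>\<^bsub>M m\<^esub>" by (simp only: nat_pow_one)
  also have "\<dots> = M_class m []" by (simp add: M_def presented_monoid_def)
  finally show ?thesis using True by (simp add: start_word_def)
next
  case False
  then show ?thesis using rho_pow[of m "m + 1"] by (simp add: start_word_def)
qed

lemma nonroot_word_cong_start_word:
  assumes "schroeder t" "leaves t = m + 1"
  shows "(nonroot_word m t, start_word m) \<in> pres_cong {1..m} (M_rels m)"
proof (cases "t = Leaf")
  case True
  then show ?thesis using assms by (auto simp: start_word_def intro: M_cong_refl[of "[]" 0, simplified])
next
  case False
  then have "m \<noteq> 0" using assms leaves_eq_1_iff[of t] by auto
  then show ?thesis using nonroot_word_cong(1)[of t m] assms False by (simp add: start_word_def)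
qed

text \<open>Follows a chain of relation steps from \<open>start_word m\<close>, lifting each to a
  local move; these preserve the number of leaves.\<close>

lemma nonroot_word_surj:
  assumes "(w, start_word m) \<in> pres_cong {1..m} (M_rels m)"
  shows "\<exists>t. schroeder t \<and> leaves t = m + 1 \<and> nonroot_word m t = w"
proof -
  let ?S = "rel_step {1..m} (M_rels m) \<union> (rel_step {1..m} (M_rels m))\<inverse>"
  have "(start_word m, w) \<in> ?S\<^sup>*"
    using M_cong_sym[OF assms] unfolding pres_cong_def by blast
  then show ?thesis
  proof induction
    case base
    \<comment> \<open>The corolla has only letters \<open>m\<close>, since its leftmost leaf has
      \<open>m\<close> leaves to its right. For \<open>m = 0\<close> it would have a single child,
      so \<open>Leaf\<close> is taken.\<close>
    define t where "t = (if m = 0 then Leaf else Node (replicate (m + 1) Leaf))"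
    have "concat (replicate k [m]) = replicate k m" for k by (induction k) auto
    then have "nonroot_word m t = start_word m"
      by (auto simp: t_def start_word_def sum_list_replicate)
    moreover have "schroeder t" "leaves t = m + 1"
      by (auto simp: t_def sum_list_replicate)
    ultimately show ?case by blast
  next
    case (step w w')
    then obtain t where t: "schroeder t" "leaves t = m + 1" "nonroot_word m t = w" by blast
    obtain u v i where i: "1 \<le> i" and
      "w = u @ [1, m, i] @ v \<and> w' = u @ [i + 1, m] @ v \<or>
       w = u @ [i + 1, m] @ v \<and> w' = u @ [1, m, i] @ v"
      using step.hyps(2) unfolding rel_step_def M_rels_def by blast
    then consider "w = u @ [1, m, i] @ v" "w' = u @ [i + 1, m] @ v"
      | "w = u @ [i + 1, m] @ v" "w' = u @ [1, m, i] @ v" by blast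
    then show ?case
    proof cases
      case 1
      then obtain t' where "contraction t t'" "schroeder t'" "nonroot_word m t' = w'"
        using contract_factor[of m t u i v] t by auto
      then show ?thesis using contraction_leaves t by metis
    next
      case 2
      then obtain t' where "contraction t' t" "schroeder t'" "nonroot_word m t' = w'"
        using expand_factor[of m t u i v] t i by auto
      then show ?thesis using contraction_leaves t by metis
    qed
  qed
qed

text \<open>Backwards, lifting the step from \<open>s\<close> gives a tree with the word of
  \<open>t\<close>, which is \<open>t\<close> by unique parsing.\<close>

lemma contraction_iff_rel_step:
  assumes "schroeder s" "leaves s = m + 1" "schroeder t" "leaves t = m + 1"
  shows "contraction s t \<longleftrightarrow> (nonroot_word m s, nonroot_word m t) \<in> rel_step {1..m} (M_rels m)"
proof
  assume "contraction s t"
  then show "(nonroot_word m s, nonroot_word m t) \<in> rel_step {1..m} (M_rels m)"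
    using contraction_rel_step assms by simp
next
  assume "(nonroot_word m s, nonroot_word m t) \<in> rel_step {1..m} (M_rels m)"
  then obtain u v i where *: "nonroot_word m s = u @ [1, m, i] @ v" "nonroot_word m t = u @ [i + 1, m] @ v"
    unfolding rel_step_def M_rels_def by blast
  then obtain t' where t': "contraction s t'" "schroeder t'" "nonroot_word m t' = nonroot_word m t"
    using contract_factor[of m s u i v] assms by auto
  then have "leaves t' = leaves t" using contraction_leaves assms by metis
  then have "t' = t" using nonroot_word_cancel[of "[]" m t' "[]" t] t' assms by simp
  with t' show "contraction s t" by simp
qed

lemma adjacency_graph_edge_iff:
  assumes "x \<in> V" "y \<in> V" "\<And>a b. adj a b \<Longrightarrow> adj b a"
  shows "{x, y} \<in> snd (adjacency_graph V adj) \<longleftrightarrow> adj x y"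
  using assms unfolding adjacency_graph_def by (auto simp: doubleton_eq_iff)

theorem corollary3p13:
  fixes n :: nat
  assumes "n \<ge> 1"
  shows "graph_iso (Phi (n - 1)) (tree_graph n)
           (word_graph (n - 1) (rho (n - 1) (n - 1) [^]\<^bsub>M (n - 1)\<^esub> n))"
proof -
  define m where "m = n - 1"
  have n: "n = m + 1" using assms by (simp add: m_def)
  let ?T = "{t. schroeder t \<and> leaves t = m + 1}"
  let ?W = "{v. (v, start_word m) \<in> pres_cong {1..m} (M_rels m)}"
  have words: "words_for m (rho m m [^]\<^bsub>M m\<^esub> (m + 1)) = ?W"
    unfolding rho_pow_start_word by (rule words_for_class[OF start_word_in_lists])
  have Phi: "Phi m t = nonroot_word m t" if "t \<in> ?T" for t
    using that Phi_eq_nonroot_word by blast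
  have "inj_on (nonroot_word m) ?T"
    using nonroot_word_cancel[of "[]" m _ "[]"] by (auto intro!: inj_onI)
  moreover have "nonroot_word m ` ?T = ?W"
    using nonroot_word_cong_start_word nonroot_word_surj by blast
  ultimately have "bij_betw (nonroot_word m) ?T ?W"
    unfolding bij_betw_def by blast
  then have bij: "bij_betw (Phi m) ?T ?W"
    using bij_betw_cong[of ?T "Phi m" "nonroot_word m" ?W] Phi by blast
  have "{x, y} \<in> snd (tree_graph (m + 1)) \<longleftrightarrow>
      {Phi m x, Phi m y} \<in> snd (word_graph m (rho m m [^]\<^bsub>M m\<^esub> (m + 1)))"
    if xy: "x \<in> ?T" "y \<in> ?T" for x y
  proof -
    have "Phi m x \<in> ?W" "Phi m y \<in> ?W" using bij xy bij_betwE by blast+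
    \<comment> \<open>Both edge relations are symmetric closures, so it suffices to match
      contractions with directed relation steps.\<close>
    then show ?thesis
      unfolding tree_graph_def word_graph_def words
      using xy Phi contraction_iff_rel_step[of _ m]
      by (subst (1 2) adjacency_graph_edge_iff) (auto simp: local_move_def)
  qed
  then show ?thesis
    using bij words unfolding n by (simp add: graph_iso_def tree_graph_def word_graph_def adjacency_graph_def)
qed

end
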